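(* Fix $n\ge 2$, and let $\mathcal M_{\mathrm{Fact}}$ be the class of single-head factorized sequence maps $f:\mathbb{R}^{d\times n}\to\mathbb{R}^{p\times n}$ and $\mathcal M_{\mathrm{Dyn}}$ the class of linear time-invariant SSM (state space model) maps, both defined in the context. (The class $\mathcal M_{\mathrm{Fact}}$ includes single-head softmax attention and single-head linear attention as special cases.) Then there exists $F\in\mathcal M_{\mathrm{Dyn}}$ whose impulse-response operators $\{W(\tau)\}_{\tau=0}^{n-1}$ are not all collinear such that $$\inf_{f\in\mathcal M_{\mathrm{Fact}}}\|F-f\|_\infty\;\ge\;1,$$ independent of $n$. In particular, no single-head factorized model with one shared matrix $V$ can uniformly approximate $F$.
   Context: Inputs are matrices $X=[x_1,\dots,x_n]\in\mathbb{R}^{d\times n}$ with columns $x_j\in\mathbb{R}^d$; outputs are matrices in $\mathbb{R}^{p\times n}$, whose $i$-th column is the output at position $i$. $\|\cdot\|_F$ is the Frobenius norm. Uniform (supremum) error over the unit Frobenius ball: $\|F-f\|_\infty:=\sup_{\|X\|_F\le 1}\|F(X)-f(X)\|_F$. $\mathcal M_{\mathrm{Fact}}$ is the class of sequence maps $f:\mathbb{R}^{d\times n}\to\mathbb{R}^{p\times n}$, $f(X)=[\hat y_1,\dots,\hat y_n]$, for which there exist a single shared matrix $V\in\mathbb{R}^{p\times d}$ and scalar functions $\alpha_{ij}:\mathbb{R}^{d\times n}\to\mathbb{R}$ such that, for all inputs $X=[x_1,\dots,x_n]$ and all $i$, $$\hat y_i=\sum_{j=1}^n\alpha_{ij}(X)\,Vx_j.$$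 Single-head softmax attention is the case $\alpha_{ij}(X)=\mathrm{softmax}_j\big((W_Qx_i)^\top(W_Kx_j)/\sqrt{d_k}\big)$ with query and key matrices $W_Q,W_K$ having $d_k$ rows; single-head linear attention is the case $\alpha_{ij}(X)=\phi(W_Qx_i)^\top\psi(W_Kx_j)$ with feature maps $\phi,\psi$ into $\mathbb{R}^r$. $\mathcal M_{\mathrm{Dyn}}$ is the class of linear time-invariant SSM maps $F(X)=[y_1,\dots,y_n]$ of the form $$y_i=\sum_{j=1}^{i}W(i-j)\,x_j,\qquad W(\tau)=C\bar A^{\tau}\bar B,$$ where $\bar A\in\mathbb{R}^{s\times s}$ is the state transition matrix, $\bar B\in\mathbb{R}^{s\times d}$ the input projection and $C\in\mathbb{R}^{p\times s}$ the output projection, $s$ being the state dimension. The matrices $W(\tau)$ are the impulse-response operators; they are collinear if they are all scalar multiples of a single matrix.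
   Formalization: The dimensions are assumed to satisfy dp ≥ 2, since for d = p = 1 all operators W(τ) are scalars and hence collinear, so no F as claimed exists; the result is proved for all other positive d and p. *)

theory Defs
  imports
    "Jordan_Normal_Form.Matrix"
    "HOL-Library.Extended_Real"
begin

text \<open>
  A sequence of \<open>n\<close> vectors of length \<open>d\<close> is a matrix in \<open>carrier_mat d n\<close>, its columns being the
  entries of the sequence. Positions are numbered from \<open>0\<close>, so the positions are \<open>i < n\<close>.
  Sequence maps are only constrained on the carrier; their values elsewhere are irrelevant.
\<close>

definition frobenius_norm :: "real mat \<Rightarrow> real" where
  "frobenius_norm X = sqrt (\<Sum>i<dim_row X. \<Sum>j<dim_col X. (X $$ (i, j))\<^sup>2)"

text \<open>
  The supremum is taken in the extended reals: the coefficient functions of a factorized map are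
  arbitrary, so the error may be infinite.
\<close>

definition unif_error :: "nat \<Rightarrow> nat \<Rightarrow> (real mat \<Rightarrow> real mat) \<Rightarrow> (real mat \<Rightarrow> real mat) \<Rightarrow> ereal" where
  "unif_error d n F f =
     (SUP X \<in> {X \<in> carrier_mat d n. frobenius_norm X \<le> 1}. ereal (frobenius_norm (F X - f X)))"

definition factorized_by ::
  "nat \<Rightarrow> nat \<Rightarrow> nat \<Rightarrow> real mat \<Rightarrow> (nat \<Rightarrow> nat \<Rightarrow> real mat \<Rightarrow> real) \<Rightarrow> (real mat \<Rightarrow> real mat) \<Rightarrow> bool" where
  "factorized_by d p n V \<alpha> f \<longleftrightarrow>
     V \<in> carrier_mat p d \<and>
     (\<forall>X \<in> carrier_mat d n.
        f X \<in> carrier_mat p n \<and>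
        (\<forall>i<n. col (f X) i =
           finsum_vec TYPE(real) p (\<lambda>j. \<alpha> i j X \<cdot>\<^sub>v (V *\<^sub>v col X j)) {..<n}))"

definition M_Fact :: "nat \<Rightarrow> nat \<Rightarrow> nat \<Rightarrow> (real mat \<Rightarrow> real mat) set" where
  "M_Fact d p n = {f. \<exists>V \<alpha>. factorized_by d p n V \<alpha> f}"

definition softmax :: "nat \<Rightarrow> (nat \<Rightarrow> real) \<Rightarrow> nat \<Rightarrow> real" where
  "softmax n z j = exp (z j) / (\<Sum>k<n. exp (z k))"

definition softmax_attention :: "nat \<Rightarrow> nat \<Rightarrow> nat \<Rightarrow> (real mat \<Rightarrow> real mat) set" where
  "softmax_attention d p n = {f. \<exists>d\<^sub>k W\<^sub>Q W\<^sub>K V.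
     0 < d\<^sub>k \<and> W\<^sub>Q \<in> carrier_mat d\<^sub>k d \<and> W\<^sub>K \<in> carrier_mat d\<^sub>k d \<and>
     factorized_by d p n V
       (\<lambda>i j X. softmax n (\<lambda>k. ((W\<^sub>Q *\<^sub>v col X i) \<bullet> (W\<^sub>K *\<^sub>v col X k)) / sqrt (real d\<^sub>k)) j) f}"

definition linear_attention :: "nat \<Rightarrow> nat \<Rightarrow> nat \<Rightarrow> (real mat \<Rightarrow> real mat) set" where
  "linear_attention d p n = {f. \<exists>d\<^sub>k r W\<^sub>Q W\<^sub>K V \<phi> \<psi>.
     W\<^sub>Q \<in> carrier_mat d\<^sub>k d \<and> W\<^sub>K \<in> carrier_mat d\<^sub>k d \<and>
     \<phi> \<in> carrier_vec d\<^sub>k \<rightarrow> carrier_vec r \<and> \<psi> \<in> carrier_vec d\<^sub>k \<rightarrow> carrier_vec r \<and>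
     factorized_by d p n V
       (\<lambda>i j X. \<phi> (W\<^sub>Q *\<^sub>v col X i) \<bullet> \<psi> (W\<^sub>K *\<^sub>v col X j)) f}"

definition impulse_response :: "real mat \<Rightarrow> real mat \<Rightarrow> real mat \<Rightarrow> nat \<Rightarrow> real mat" where
  "impulse_response A B C \<tau> = C * (A ^\<^sub>m \<tau>) * B"

definition ssm_realization ::
  "nat \<Rightarrow> nat \<Rightarrow> nat \<Rightarrow> nat \<Rightarrow> real mat \<Rightarrow> real mat \<Rightarrow> real mat \<Rightarrow> (real mat \<Rightarrow> real mat) \<Rightarrow> bool" where
  "ssm_realization d p n s A B C F \<longleftrightarrow>
     A \<in> carrier_mat s s \<and> B \<in> carrier_mat s d \<and> C \<in> carrier_mat p s \<and>
     (\<forall>X \<in> carrier_mat d n.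
        F X \<in> carrier_mat p n \<and>
        (\<forall>i<n. col (F X) i =
           finsum_vec TYPE(real) p (\<lambda>j. impulse_response A B C (i - j) *\<^sub>v col X j) {..i}))"

definition M_Dyn :: "nat \<Rightarrow> nat \<Rightarrow> nat \<Rightarrow> (real mat \<Rightarrow> real mat) set" where
  "M_Dyn d p n = {F. \<exists>s A B C. ssm_realization d p n s A B C F}"

definition collinear_mats :: "nat \<Rightarrow> nat \<Rightarrow> real mat set \<Rightarrow> bool" where
  "collinear_mats p d S \<longleftrightarrow> (\<exists>M \<in> carrier_mat p d. \<forall>W \<in> S. \<exists>c. W = c \<cdot>\<^sub>m M)"

end

theory Submission
  imports Defs
begin

text \<open>
  Feed the models a single vector \<open>u\<close> at position \<open>0\<close>. A factorized map then returns a matrix all of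
  whose columns are multiples of \<open>V u\<close>, whereas an SSM map returns the columns \<open>W(\<tau>) u\<close>.
  If \<open>p \<ge> 2\<close>, take \<open>W(0) = e\<^sub>0 e\<^sub>0\<^sup>T\<close>, \<open>W(1) = e\<^sub>1 e\<^sub>0\<^sup>T\<close> and \<open>u = e\<^sub>0\<close>: the first two columns contain the
  \<open>2 \<times> 2\<close> identity, which has Frobenius distance at least \<open>1\<close> from every matrix of rank one.
  If \<open>p = 1\<close>, take \<open>W(0) = e\<^sub>0\<^sup>T\<close>, \<open>W(1) = e\<^sub>1\<^sup>T\<close> and a unit vector \<open>u\<close> in the plane of \<open>e\<^sub>0, e\<^sub>1\<close>
  with \<open>V u = 0\<close>: the factorized map vanishes at this input and the SSM map has norm at least \<open>1\<close>.
\<close>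

section \<open>Response of both model classes to an input with a single nonzero column\<close>

definition single_input :: "nat \<Rightarrow> nat \<Rightarrow> real vec \<Rightarrow> real mat" where
  "single_input d n u = mat d n (\<lambda>(i, j). if j = 0 then u $ i else 0)"

lemma single_input_carrier [simp]: "single_input d n u \<in> carrier_mat d n"
  by (simp add: single_input_def)

lemma col_single_input:
  assumes "u \<in> carrier_vec d" and "j < n"
  shows "col (single_input d n u) j = (if j = 0 then u else 0\<^sub>v d)"
  using assms by (intro eq_vecI) (auto simp: single_input_def)

lemma frobenius_norm_single_input:
  assumes "0 < n"
  shows "frobenius_norm (single_input d n u) = sqrt (\<Sum>i<d. (u $ i)\<^sup>2)"
proof -
  have "(\<Sum>j<n. (single_input d n u $$ (i, j))\<^sup>2) = (u $ i)\<^sup>2" if "i < d" for i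
  proof -
    have "(\<Sum>j<n. (single_input d n u $$ (i, j))\<^sup>2) = (\<Sum>j<n. if j = 0 then (u $ i)\<^sup>2 else 0)"
      using that by (intro sum.cong) (auto simp: single_input_def)
    then show ?thesis
      using assms by simp
  qed
  moreover have "dim_row (single_input d n u) = d" "dim_col (single_input d n u) = n"
    by (simp_all add: single_input_def)
  ultimately show ?thesis
    by (simp add: frobenius_norm_def)
qed

text \<open>Only the term \<open>j = 0\<close> survives, because \<open>V\<close> sends the other,
  zero columns to zero. The position \<open>i\<close> enters only through the scalar coefficient, so
  the output matrix has rank at most one.\<close>

lemma factorized_by_single_input:
  assumes f: "factorized_by d p n V \<alpha> f" and u: "u \<in> carrier_vec d" and "i < n" "k < p"
  shows "f (single_input d n u) $$ (k, i) = \<alpha> i 0 (single_input d n u) * (V *\<^sub>v u) $ k"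
proof -
  let ?X = "single_input d n u"
  let ?g = "\<lambda>j. \<alpha> i j ?X \<cdot>\<^sub>v (V *\<^sub>v col ?X j)"
  have V: "V \<in> carrier_mat p d" and fX: "f ?X \<in> carrier_mat p n"
    and col: "col (f ?X) i = finsum_vec TYPE(real) p ?g {..<n}"
    using f \<open>i < n\<close> by (auto simp: factorized_by_def)
  have "?g \<in> {..<n} \<rightarrow> carrier_vec p"
    using V by auto
  then have "f ?X $$ (k, i) = (\<Sum>j<n. ?g j $ k)"
    using fX col \<open>i < n\<close> \<open>k < p\<close> index_finsum_vec[of "{..<n}" k p ?g]
    by (simp flip: index_col)
  also have "\<dots> = (\<Sum>j<n. if j = 0 then \<alpha> i 0 ?X * (V *\<^sub>v u) $ k else 0)"
    using V u \<open>k < p\<close> by (intro sum.cong) (auto simp: col_single_input)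
  finally show ?thesis
    using \<open>i < n\<close> by simp
qed

text \<open>Again only \<open>j = 0\<close> contributes, and it has lag \<open>i - 0 = i\<close>:
  the output reads off the impulse response applied to \<open>u\<close>.\<close>

lemma ssm_realization_single_input:
  assumes F: "ssm_realization d p n s A B C F" and u: "u \<in> carrier_vec d" and "i < n" "k < p"
  shows "F (single_input d n u) $$ (k, i) = (impulse_response A B C i *\<^sub>v u) $ k"
proof -
  let ?X = "single_input d n u"
  let ?g = "\<lambda>j. impulse_response A B C (i - j) *\<^sub>v col ?X j"
  have A: "A \<in> carrier_mat s s" and BC: "B \<in> carrier_mat s d" "C \<in> carrier_mat p s"
    and FX: "F ?X \<in> carrier_mat p n" and col: "col (F ?X) i = finsum_vec TYPE(real) p ?g {..i}"
    using F \<open>i < n\<close> by (auto simp: ssm_realization_def)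
  have W: "impulse_response A B C \<tau> \<in> carrier_mat p d" for \<tau>
    using BC by (auto simp: impulse_response_def)
  have "?g \<in> {..i} \<rightarrow> carrier_vec p"
    using \<open>i < n\<close> u by (auto intro!: mult_mat_vec_carrier[OF W] simp: col_single_input)
  then have "F ?X $$ (k, i) = (\<Sum>j\<le>i. ?g j $ k)"
    using FX col \<open>i < n\<close> \<open>k < p\<close> index_finsum_vec[of "{..i}" k p ?g]
    by (simp flip: index_col)
  also have "\<dots> = (\<Sum>j\<le>i. if j = 0 then (impulse_response A B C i *\<^sub>v u) $ k else 0)"
    using W[THEN carrier_matD(1)] W[THEN carrier_matD(2)] u \<open>k < p\<close> \<open>i < n\<close>
    by (intro sum.cong) (auto simp: col_single_input scalar_prod_def)
  finally show ?thesis
    by simp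
qed

lemma ssm_realization_exists:
  assumes "A \<in> carrier_mat s s" "B \<in> carrier_mat s d" "C \<in> carrier_mat p s"
  shows "\<exists>F. ssm_realization d p n s A B C F"
proof -
  let ?y = "\<lambda>X i. finsum_vec TYPE(real) p (\<lambda>j. impulse_response A B C (i - j) *\<^sub>v col X j) {..i}"
  have "impulse_response A B C \<tau> \<in> carrier_mat p d" for \<tau>
    using assms by (auto simp: impulse_response_def)
  then have "?y X i \<in> carrier_vec p" if "X \<in> carrier_mat d n" for X i
    using that by (intro finsum_vec_closed) (auto intro!: mult_mat_vec_carrier)
  then have "ssm_realization d p n s A B C (\<lambda>X. mat_of_cols p (map (?y X) [0..<n]))"
    using assms by (auto simp: ssm_realization_def)
  then show ?thesis
    by blast
qed

section \<open>Lower bounds for norms and the two planar estimates\<close>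

lemma unif_error_ge:
  assumes "X \<in> carrier_mat d n" "frobenius_norm X \<le> 1" "c \<le> frobenius_norm (F X - f X)"
  shows "ereal c \<le> unif_error d n F f"
  unfolding unif_error_def using assms by (intro SUP_upper2[of X]) auto

text \<open>Lets the error be estimated on a small block in which all entries are known.\<close>

lemma sum_entries_le_frobenius_norm:
  assumes "S \<subseteq> {..<dim_row X} \<times> {..<dim_col X}"
  shows "sqrt (\<Sum>ij\<in>S. (X $$ ij)\<^sup>2) \<le> frobenius_norm X"
proof -
  have "(\<Sum>ij\<in>S. (X $$ ij)\<^sup>2) \<le> (\<Sum>ij\<in>{..<dim_row X} \<times> {..<dim_col X}. (X $$ ij)\<^sup>2)"
    using assms by (intro sum_mono2) auto
  then show ?thesis
    by (simp add: frobenius_norm_def sum.cartesian_product case_prod_unfold)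
qed

text \<open>The right-hand side is the squared Frobenius distance from the
  \<open>2 \<times> 2\<close> identity to the matrix N with columns \<open>a (v, w)\<close> and
  \<open>b (v, w)\<close>.\<close>

lemma identity_rank_one_distance:
  fixes a b v w :: real
  shows "1 \<le> (1 - a * v)\<^sup>2 + (a * w)\<^sup>2 + (b * v)\<^sup>2 + (1 - b * w)\<^sup>2"
proof -
  \<comment> \<open>Since det N = 0, the squared norm of N is its squared trace plus the squared
    difference of its off-diagonal entries; completing the square in the trace leaves 1.\<close>
  have "(1 - a * v)\<^sup>2 + (a * w)\<^sup>2 + (b * v)\<^sup>2 + (1 - b * w)\<^sup>2
      = 1 + (1 - a * v - b * w)\<^sup>2 + (a * w - b * v)\<^sup>2"
    by (simp add: power2_eq_square algebra_simps)
  then show ?thesis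
    by simp
qed

lemma orthogonal_unit_vector_2:
  fixes v w :: real
  obtains a b where "a\<^sup>2 + b\<^sup>2 = 1" "v * a + w * b = 0"
proof (cases "v = 0 \<and> w = 0")
  case True
  then show ?thesis
    using that[of 1 0] by simp
next
  case False
  \<comment> \<open>The witness is \<open>(v, w)\<close> turned by a right angle and
    normalised.\<close>
  define r where "r = sqrt (v\<^sup>2 + w\<^sup>2)"
  have r: "r\<^sup>2 = v\<^sup>2 + w\<^sup>2" "r\<^sup>2 \<noteq> 0"
    using False by (auto simp: r_def sum_power2_eq_zero_iff)
  have "(w / r)\<^sup>2 + (- v / r)\<^sup>2 = (w\<^sup>2 + v\<^sup>2) / r\<^sup>2"
    by (simp add: power_divide add_divide_distrib)
  then show ?thesis
    using r by (intro that[of "w / r" "- v / r"]) (simp_all add: add.commute)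
qed

section \<open>Matrix units, and systems having them as impulse responses\<close>

definition elem_mat :: "nat \<Rightarrow> nat \<Rightarrow> nat \<Rightarrow> nat \<Rightarrow> real mat" where
  "elem_mat p d k l = mat p d (\<lambda>(i, j). if i = k \<and> j = l then 1 else 0)"

lemma elem_mat_mult_vec:
  assumes "u \<in> carrier_vec d" "l < d" "i < p"
  shows "(elem_mat p d k l *\<^sub>v u) $ i = (if i = k then u $ l else 0)"
proof -
  have "(elem_mat p d k l *\<^sub>v u) $ i = (\<Sum>j = 0..<d. (if i = k \<and> j = l then 1 else 0) * u $ j)"
    using assms by (simp add: elem_mat_def scalar_prod_def)
  also have "\<dots> = (\<Sum>j = 0..<d. if j = l then (if i = k then u $ l else 0) else 0)"
    by (intro sum.cong) auto
  finally show ?thesis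
    using assms(2) by simp
qed

lemma not_collinear_elem_mats:
  assumes "elem_mat p d k l \<in> S" "elem_mat p d k' l' \<in> S" "(k, l) \<noteq> (k', l')"
    and "k < p" "l < d" "k' < p" "l' < d"
  shows "\<not> collinear_mats p d S"
proof
  assume "collinear_mats p d S"
  then obtain M c c' where M: "M \<in> carrier_mat p d"
    and c: "elem_mat p d k l = c \<cdot>\<^sub>m M" and c': "elem_mat p d k' l' = c' \<cdot>\<^sub>m M"
    using assms(1,2) unfolding collinear_mats_def by meson
  \<comment> \<open>The first equation makes the entry of \<open>M\<close> at \<open>(k, l)\<close>
    nonzero, so the second forces \<open>c' = 0\<close>, against the third.\<close>
  have "c * M $$ (k, l) = 1" "c' * M $$ (k, l) = 0" "c' * M $$ (k', l') = 1"
    using arg_cong[OF c, of "\<lambda>N. N $$ (k, l)"] arg_cong[OF c', of "\<lambda>N. N $$ (k, l)"]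
      arg_cong[OF c', of "\<lambda>N. N $$ (k', l')"] M assms(3-)
    by (auto simp: elem_mat_def)
  then show False
    by auto
qed

text \<open>\<open>B\<close> loads input coordinate 0 into state coordinate 0, the nilpotent
  \<open>A\<close> moves it to state coordinate 1 one step later, and \<open>C\<close> copies the
  two state coordinates to the first two output rows.\<close>

lemma ssm_with_two_row_responses:
  assumes "2 \<le> p"
  obtains A B C where "A \<in> carrier_mat 2 2" "B \<in> carrier_mat 2 d" "C \<in> carrier_mat p 2"
    "impulse_response A B C 0 = elem_mat p d 0 0" "impulse_response A B C 1 = elem_mat p d 1 0"
proof (rule that)
  let ?A = "elem_mat 2 2 1 0" and ?B = "elem_mat 2 d 0 0"
    and ?C = "mat p 2 (\<lambda>(i, j). if i = j then 1 else 0)"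
  show "?A \<in> carrier_mat 2 2" "?B \<in> carrier_mat 2 d" "?C \<in> carrier_mat p 2"
    by (simp_all add: elem_mat_def)
  show "impulse_response ?A ?B ?C 0 = elem_mat p d 0 0"
    "impulse_response ?A ?B ?C 1 = elem_mat p d 1 0"
    by (intro eq_matI;
        auto simp: impulse_response_def elem_mat_def scalar_prod_def numeral_2_eq_2)+
qed

text \<open>The transposed construction: \<open>B\<close> loads input coordinates 0 and 1,
  \<open>C\<close> outputs state coordinate 0 only, and \<open>A\<close> moves state coordinate 1
  there with a delay of one step.\<close>

lemma ssm_with_two_column_responses:
  assumes "2 \<le> d"
  obtains A B C where "A \<in> carrier_mat 2 2" "B \<in> carrier_mat 2 d" "C \<in> carrier_mat p 2"
    "impulse_response A B C 0 = elem_mat p d 0 0" "impulse_response A B C 1 = elem_mat p d 0 1"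
proof (rule that)
  let ?A = "elem_mat 2 2 0 1" and ?C = "elem_mat p 2 0 0"
    and ?B = "mat 2 d (\<lambda>(i, j). if i = j then 1 else 0)"
  show "?A \<in> carrier_mat 2 2" "?B \<in> carrier_mat 2 d" "?C \<in> carrier_mat p 2"
    by (simp_all add: elem_mat_def)
  show "impulse_response ?A ?B ?C 0 = elem_mat p d 0 0"
    "impulse_response ?A ?B ?C 1 = elem_mat p d 0 1"
    by (intro eq_matI;
        auto simp: impulse_response_def elem_mat_def scalar_prod_def numeral_2_eq_2)+
qed

section \<open>Error bounds in the two cases, and choice of the system\<close>

lemma unif_error_ge_1_two_row_responses:
  assumes "2 \<le> n" "2 \<le> p" "0 < d"
    and F: "ssm_realization d p n s A B C F"
    and W0: "impulse_response A B C 0 = elem_mat p d 0 0"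
    and W1: "impulse_response A B C 1 = elem_mat p d 1 0"
    and f: "factorized_by d p n V \<alpha> f"
  shows "1 \<le> unif_error d n F f"
proof -
  define u :: "real vec" where "u = unit_vec d 0"
  have u: "u \<in> carrier_vec d" "u $ 0 = 1"
    using \<open>0 < d\<close> by (simp_all add: u_def)
  let ?X = "single_input d n u"
  let ?G = "F ?X - f ?X"
  have carr: "F ?X \<in> carrier_mat p n" "f ?X \<in> carrier_mat p n"
    using F f by (auto simp: ssm_realization_def factorized_by_def)
  \<comment> \<open>The SSM output has first columns \<open>e_0\<close> and \<open>e_1\<close>, so
    on the top left block the error is the identity minus a matrix of rank at most one.\<close>
  have G: "?G $$ (k, i) = (if k = i then 1 else 0) - \<alpha> i 0 ?X * (V *\<^sub>v u) $ k"
    if "k < 2" "i < 2" for k i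
  proof -
    have "(impulse_response A B C i *\<^sub>v u) $ k = (if k = i then 1 else 0)"
      using that W0 W1 u assms(2,3) by (auto simp: elem_mat_mult_vec less_2_cases_iff)
    then show ?thesis
      using that carr u assms(1,2)
      by (simp add: ssm_realization_single_input[OF F] factorized_by_single_input[OF f])
  qed
  have "1 \<le> (\<Sum>ki\<in>{..<2} \<times> {..<2}. (?G $$ ki)\<^sup>2)"
    using identity_rank_one_distance[of "\<alpha> 0 0 ?X" "(V *\<^sub>v u) $ 0" "(V *\<^sub>v u) $ 1" "\<alpha> 1 0 ?X"]
    by (simp add: sum.cartesian_product' G numeral_2_eq_2)
  also have "sqrt \<dots> \<le> frobenius_norm ?G"
    using carr assms(1,2) by (intro sum_entries_le_frobenius_norm) auto
  finally have "1 \<le> frobenius_norm ?G"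
    by simp
  moreover have "(\<Sum>i<d. (u $ i)\<^sup>2) = (\<Sum>i<d. if i = 0 then 1 else 0)"
    by (intro sum.cong) (auto simp: u_def)
  then have "frobenius_norm ?X \<le> 1"
    using assms(1,3) by (simp add: frobenius_norm_single_input)
  ultimately show ?thesis
    using unif_error_ge[of ?X d n 1 F f] by (simp add: one_ereal_def)
qed

lemma unif_error_ge_1_two_column_responses:
  assumes "2 \<le> n" "2 \<le> d"
    and F: "ssm_realization d 1 n s A B C F"
    and W0: "impulse_response A B C 0 = elem_mat 1 d 0 0"
    and W1: "impulse_response A B C 1 = elem_mat 1 d 0 1"
    and f: "factorized_by d 1 n V \<alpha> f"
  shows "1 \<le> unif_error d n F f"
proof -
  \<comment> \<open>With one output row, \<open>V\<close> restricted to the span of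
    \<open>e_0\<close> and \<open>e_1\<close> has a nontrivial kernel. The test input depends on
    \<open>V\<close>, as it may: the supremum ranges over all inputs, while \<open>F\<close> stays
    fixed.\<close>
  obtain a b where ab: "a\<^sup>2 + b\<^sup>2 = 1" "V $$ (0, 0) * a + V $$ (0, 1) * b = 0"
    by (rule orthogonal_unit_vector_2[of "V $$ (0, 0)" "V $$ (0, 1)"])
  define u where "u = vec d (\<lambda>i. if i = 0 then a else if i = 1 then b else 0)"
  have u: "u \<in> carrier_vec d" "u $ 0 = a" "u $ 1 = b"
    using \<open>2 \<le> d\<close> by (simp_all add: u_def)
  have sum_d: "(\<Sum>i<d. h i) = h 0 + h 1" if "\<And>i. 2 \<le> i \<Longrightarrow> i < d \<Longrightarrow> h i = 0" for h :: "nat \<Rightarrow> real"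
  proof -
    have "(\<Sum>i<d. h i) = (\<Sum>i<2. h i)"
      using \<open>2 \<le> d\<close> that by (intro sum.mono_neutral_right) auto
    then show ?thesis
      by (simp add: numeral_2_eq_2)
  qed
  let ?X = "single_input d n u"
  let ?G = "F ?X - f ?X"
  have carr: "F ?X \<in> carrier_mat 1 n" "f ?X \<in> carrier_mat 1 n" and V: "V \<in> carrier_mat 1 d"
    using F f by (auto simp: ssm_realization_def factorized_by_def)
  have "(V *\<^sub>v u) $ 0 = (\<Sum>i<d. V $$ (0, i) * u $ i)"
    using V u by (auto simp: scalar_prod_def lessThan_atLeast0 intro!: sum.cong)
  also have "\<dots> = 0"
    using ab u by (subst sum_d) (auto simp: u_def)
  finally have Vu: "(V *\<^sub>v u) $ 0 = 0" .
  \<comment> \<open>The factorized map vanishes at this input, and the SSM outputs \<open>a\<close>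
    at once and \<open>b\<close> one step later; these two entries already have norm 1.\<close>
  have "?G $$ (0, 0) = a" "?G $$ (0, 1) = b"
    using carr u assms(1,2) Vu W0 W1
    by (simp_all add: ssm_realization_single_input[OF F] factorized_by_single_input[OF f]
        elem_mat_mult_vec)
  then have "(\<Sum>ki\<in>{..<1} \<times> {..<2}. (?G $$ ki)\<^sup>2) = 1"
    using ab(1) by (simp add: sum.cartesian_product' numeral_2_eq_2)
  moreover have "sqrt (\<Sum>ki\<in>{..<1} \<times> {..<2}. (?G $$ ki)\<^sup>2) \<le> frobenius_norm ?G"
    using carr assms(1) by (intro sum_entries_le_frobenius_norm) auto
  ultimately have "1 \<le> frobenius_norm ?G"
    by simp
  moreover have "(\<Sum>i<d. (u $ i)\<^sup>2) = 1"
    using ab(1) u by (subst sum_d) (auto simp: u_def)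
  then have "frobenius_norm ?X \<le> 1"
    using assms(1) by (simp add: frobenius_norm_single_input)
  ultimately show ?thesis
    using unif_error_ge[of ?X d n 1 F f] by (simp add: one_ereal_def)
qed

text \<open>The system is fixed by \<open>d\<close> and \<open>p\<close> before any \<open>f\<close>
  is given. For \<open>d * p < 2\<close> the \<open>p \<times> d\<close> matrices form a space of
  dimension at most one, so all responses would be collinear.\<close>

lemma ssm_far_from_factorized:
  assumes "2 \<le> n" "2 \<le> d * p"
  obtains s A B C F where "ssm_realization d p n s A B C F"
    "\<not> collinear_mats p d (impulse_response A B C ` {0..n - 1})"
    "\<And>f. f \<in> M_Fact d p n \<Longrightarrow> 1 \<le> unif_error d n F f"
proof -
  have pos: "0 < d" "0 < p"
    using assms(2) by (auto intro: Nat.gr0I)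
  \<comment> \<open>Lag 1 lies in the range because \<open>n \<ge> 2\<close>.\<close>
  have range: "impulse_response A B C \<tau> \<in> impulse_response A B C ` {0..n - 1}"
    if "\<tau> = 0 \<or> \<tau> = 1" for A B C \<tau>
    using assms(1) that by auto
  show ?thesis
  proof (cases "2 \<le> p")
    case True
    then obtain A B C where
      ABC: "A \<in> carrier_mat 2 2" "B \<in> carrier_mat 2 d" "C \<in> carrier_mat p 2"
      and W: "impulse_response A B C 0 = elem_mat p d 0 0"
        "impulse_response A B C 1 = elem_mat p d 1 0"
      by (rule ssm_with_two_row_responses)
    obtain F where F: "ssm_realization d p n 2 A B C F"
      using ssm_realization_exists[OF ABC] by blast
    have nc: "\<not> collinear_mats p d (impulse_response A B C ` {0..n - 1})"
      using range[of 0 A B C] range[of 1 A B C] True pos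
      by (intro not_collinear_elem_mats[of p d 0 0 _ 1 0]) (simp_all add: W[simplified])
    have "1 \<le> unif_error d n F f" if "f \<in> M_Fact d p n" for f
      using that unif_error_ge_1_two_row_responses[OF assms(1) True pos(1) F W]
      by (auto simp: M_Fact_def)
    then show ?thesis
      using F nc by (intro that)
  next
    case False
    then have p: "p = 1" and d: "2 \<le> d"
      using pos assms(2) by (auto simp: not_le less_2_cases_iff)
    obtain A B C where
      ABC: "A \<in> carrier_mat 2 2" "B \<in> carrier_mat 2 d" "C \<in> carrier_mat p 2"
      and W: "impulse_response A B C 0 = elem_mat p d 0 0"
        "impulse_response A B C 1 = elem_mat p d 0 1"
      using d by (rule ssm_with_two_column_responses)
    obtain F where F: "ssm_realization d p n 2 A B C F"
      using ssm_realization_exists[OF ABC] by blast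
    have nc: "\<not> collinear_mats p d (impulse_response A B C ` {0..n - 1})"
      using range[of 0 A B C] range[of 1 A B C] d pos
      by (intro not_collinear_elem_mats[of p d 0 0 _ 0 1]) (simp_all add: W[simplified])
    have "1 \<le> unif_error d n F f" if "f \<in> M_Fact d p n" for f
      using that unif_error_ge_1_two_column_responses[OF assms(1) d F[unfolded p] W[unfolded p]]
      by (auto simp: M_Fact_def p)
    then show ?thesis
      using F nc by (intro that)
  qed
qed

theorem theorem4p2:
  fixes d p n :: nat
  assumes "n \<ge> 2" and "d * p \<ge> 2"
  shows "softmax_attention d p n \<subseteq> M_Fact d p n \<and>
         linear_attention d p n \<subseteq> M_Fact d p n \<and>
         (\<exists>F \<in> M_Dyn d p n.
            (\<exists>s A B C. ssm_realization d p n s A B C F \<and>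
               \<not> collinear_mats p d (impulse_response A B C ` {0..n - 1})) \<and>
            (INF f \<in> M_Fact d p n. unif_error d n F f) \<ge> 1 \<and>
            \<not> (\<forall>\<epsilon>::real. \<epsilon> > 0 \<longrightarrow> (\<exists>f \<in> M_Fact d p n. unif_error d n F f < ereal \<epsilon>)))"
proof (intro conjI)
  \<comment> \<open>Both attention classes are given by \<open>factorized_by\<close> with particular
    coefficients, which serve as the witness \<open>\<alpha>\<close>.\<close>
  show "softmax_attention d p n \<subseteq> M_Fact d p n" "linear_attention d p n \<subseteq> M_Fact d p n"
    unfolding softmax_attention_def linear_attention_def M_Fact_def by blast+
  obtain s A B C F where F: "ssm_realization d p n s A B C F"
    and nc: "\<not> collinear_mats p d (impulse_response A B C ` {0..n - 1})"
    and far: "\<And>f. f \<in> M_Fact d p n \<Longrightarrow> 1 \<le> unif_error d n F f"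
    using ssm_far_from_factorized[OF assms] by blast
  have "(INF f \<in> M_Fact d p n. unif_error d n F f) \<ge> 1"
    using far by (intro INF_greatest)
  \<comment> \<open>Uniform approximation already fails at tolerance 1.\<close>
  moreover have "\<not> (\<exists>f \<in> M_Fact d p n. unif_error d n F f < ereal 1)"
    using far by (metis one_ereal_def not_less)
  then have "\<not> (\<forall>\<epsilon>::real. \<epsilon> > 0 \<longrightarrow> (\<exists>f \<in> M_Fact d p n. unif_error d n F f < ereal \<epsilon>))"
    by (intro notI) (drule spec[of _ 1], simp)
  moreover have "F \<in> M_Dyn d p n"
    using F by (auto simp: M_Dyn_def)
  ultimately show "\<exists>F \<in> M_Dyn d p n.
      (\<exists>s A B C. ssm_realization d p n s A B C F \<and>
         \<not> collinear_mats p d (impulse_response A B C ` {0..n - 1})) \<and>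
      (INF f \<in> M_Fact d p n. unif_error d n F f) \<ge> 1 \<and>
      \<not> (\<forall>\<epsilon>::real. \<epsilon> > 0 \<longrightarrow> (\<exists>f \<in> M_Fact d p n. unif_error d n F f < ereal \<epsilon>))"
    using F nc by blast
qed

end
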